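(* Let $n\ge 3$. For generic values of the radii $r_1,\dots,r_n$, all parades are non-degenerate critical points of the perimeter $L$ on $M'(S)$, where $S=\{C(r_1),\dots,C(r_n)\}$. Here "generic" means: there is an open dense subset $U$ of the set of all $(r_1,\dots,r_n)\in(0,\infty)^n$ with pairwise distinct entries and $r_n=\max_i r_i$, such that the assertion holds for every $(r_1,\dots,r_n)\in U$.
   Context: $C(r)$ is the circle of radius $r$ in the Euclidean plane centred at the origin $O$. An $S$-circuit is an ordered collection $P=(p_1,\dots,p_n)$ with $p_i\in C(r_i)$, regarded as a closed $n$-gon with sides $p_ip_{i+1}$ (indices modulo $n$), with perimeter $L(P)=\sum_{i=1}^n|p_ip_{i+1}|$. $C(r_n)$ is the outer circle. The reduced configuration space $M'(S)$ is the set of $S$-circuits with $p_n=(r_n,0)$ fixed; it is identified with the torus $\mathbb{T}^{n-1}$ via the polar angles of $p_1,\dots,p_{n-1}$, and $L$ is regarded as a function on it. A parade is an $S$-circuit all of whose vertices have polar angle $0$ or $\pi$; there are $2^{n-1}$ parades in $M'(S)$. A critical point is non-degenerate if the Hessian matrix of $L$ at it is invertible. *)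

theory Defs
  imports "HOL-Analysis.Analysis" "Jordan_Normal_Form.Matrix"
begin

section \<open>Circuits on concentric circles\<close>

text \<open>
  The Euclidean plane is \<^typ>\<open>complex\<close>. Tuples indexed by \<open>1, \<dots>, n\<close> are functions on \<^typ>\<open>nat\<close>
  that are extensional on \<open>{1..n}\<close>; a family of circles \<open>C(r\<^sub>1), \<dots>, C(r\<^sub>n)\<close> is given
  by its tuple of radii.
\<close>

definition circle :: "real \<Rightarrow> complex set" where
  "circle \<rho> = sphere 0 \<rho>"

definition circuits :: "nat \<Rightarrow> (nat \<Rightarrow> real) \<Rightarrow> (nat \<Rightarrow> complex) set" where
  "circuits n r = (\<Pi>\<^sub>E i\<in>{1..n}. circle (r i))"

text \<open>For \<open>i \<in> {1..n}\<close>, the cyclic successor of \<open>i\<close> is \<open>i mod n + 1\<close>.\<close>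

definition perimeter :: "nat \<Rightarrow> (nat \<Rightarrow> complex) \<Rightarrow> real" where
  "perimeter n p = (\<Sum>i=1..n. dist (p i) (p (i mod n + 1)))"

definition reduced_circuits :: "nat \<Rightarrow> (nat \<Rightarrow> real) \<Rightarrow> (nat \<Rightarrow> complex) set" where
  "reduced_circuits n r = {p \<in> circuits n r. p n = complex_of_real (r n)}"

definition parade :: "nat \<Rightarrow> (nat \<Rightarrow> complex) \<Rightarrow> bool" where
  "parade n p \<longleftrightarrow> (\<forall>i\<in>{1..n}. Arg (p i) = 0 \<or> Arg (p i) = pi)"


section \<open>The angle coordinates\<close>

text \<open>
  The parametrisation of the torus by polar angles is defined on all of \<open>\<real>\<^bsup>n-1\<^esup>\<close> and is
  \<open>2\<pi>\<close>-periodic in each angle, so it restricts to a chart of the torus around every point;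
  \<open>polar_angles n p\<close> is one representative of the point of the torus given by \<open>p\<close>.
\<close>

definition circuit_of_angles :: "nat \<Rightarrow> (nat \<Rightarrow> real) \<Rightarrow> (nat \<Rightarrow> real) \<Rightarrow> (nat \<Rightarrow> complex)" where
  "circuit_of_angles n r \<theta> =
     (\<lambda>i\<in>{1..n}. if i = n then complex_of_real (r n) else rcis (r i) (\<theta> i))"

definition polar_angles :: "nat \<Rightarrow> (nat \<Rightarrow> complex) \<Rightarrow> (nat \<Rightarrow> real)" where
  "polar_angles n p = (\<lambda>i\<in>{1..<n}. Arg (p i))"

definition perimeter_of_angles :: "nat \<Rightarrow> (nat \<Rightarrow> real) \<Rightarrow> (nat \<Rightarrow> real) \<Rightarrow> real" where
  "perimeter_of_angles n r \<theta> = perimeter n (circuit_of_angles n r \<theta>)"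

lemma circuit_of_angles_in_reduced_circuits:
  assumes "n > 0" and "\<And>i. i \<in> {1..n} \<Longrightarrow> r i > 0"
  shows "circuit_of_angles n r \<theta> \<in> reduced_circuits n r"
  using assms
  by (auto simp: circuit_of_angles_def reduced_circuits_def circuits_def circle_def
      dist_norm less_imp_le)

lemma circuit_of_angles_polar_angles:
  assumes "p \<in> reduced_circuits n r"
  shows "circuit_of_angles n r (polar_angles n p) = p"
proof
  fix i
  have p: "p \<in> extensional {1..n}" "p n = complex_of_real (r n)"
    and norm: "\<And>i. i \<in> {1..n} \<Longrightarrow> cmod (p i) = r i"
    using assms by (auto simp: reduced_circuits_def circuits_def circle_def PiE_def Pi_def dist_norm)
  show "circuit_of_angles n r (polar_angles n p) i = p i"
  proof (cases "i \<in> {1..<n}")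
    case True
    then have "cmod (p i) = r i" by (intro norm) auto
    then have "rcis (r i) (Arg (p i)) = p i" by (metis rcis_cmod_Arg)
    then show ?thesis using True by (auto simp: circuit_of_angles_def polar_angles_def)
  next
    case False
    then show ?thesis using p by (auto simp: circuit_of_angles_def extensional_def)
  qed
qed


section \<open>Critical points of functions of several real variables\<close>

text \<open>
  The variables are indexed by a set \<open>I\<close> of natural numbers, and \<open>\<real>\<^sup>I\<close> carries the product
  topology \<^term>\<open>powertop_real I\<close>.
\<close>

definition partial_deriv :: "nat \<Rightarrow> ((nat \<Rightarrow> real) \<Rightarrow> real) \<Rightarrow> (nat \<Rightarrow> real) \<Rightarrow> real" where
  "partial_deriv i f x = deriv (\<lambda>t. f (x(i := t))) (x i)"

definition C1_on :: "nat set \<Rightarrow> ((nat \<Rightarrow> real) \<Rightarrow> real) \<Rightarrow> (nat \<Rightarrow> real) set \<Rightarrow> bool" where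
  "C1_on I f U \<longleftrightarrow>
     (\<forall>i\<in>I. (\<forall>x\<in>U. (\<lambda>t. f (x(i := t))) differentiable (at (x i))) \<and>
             continuous_map (subtopology (powertop_real I) U) euclideanreal (partial_deriv i f))"

definition C2_on :: "nat set \<Rightarrow> ((nat \<Rightarrow> real) \<Rightarrow> real) \<Rightarrow> (nat \<Rightarrow> real) set \<Rightarrow> bool" where
  "C2_on I f U \<longleftrightarrow> C1_on I f U \<and> (\<forall>i\<in>I. C1_on I (partial_deriv i f) U)"

text \<open>
  \<^const>\<open>deriv\<close> is total, so regularity near the point is required explicitly: \<open>C\<^sup>1\<close> for the
  differential and \<open>C\<^sup>2\<close> for the Hessian matrix to be meaningful.
\<close>

definition critical_point :: "nat set \<Rightarrow> ((nat \<Rightarrow> real) \<Rightarrow> real) \<Rightarrow> (nat \<Rightarrow> real) \<Rightarrow> bool" where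
  "critical_point I f x \<longleftrightarrow>
     (\<exists>U. openin (powertop_real I) U \<and> x \<in> U \<and> C1_on I f U) \<and>
     (\<forall>i\<in>I. partial_deriv i f x = 0)"

text \<open>Matrix indices start at 0, whereas the variables are numbered \<open>1, \<dots>, m\<close>.\<close>

definition hessian :: "nat \<Rightarrow> ((nat \<Rightarrow> real) \<Rightarrow> real) \<Rightarrow> (nat \<Rightarrow> real) \<Rightarrow> real mat" where
  "hessian m f x =
     mat m m (\<lambda>(i, j). partial_deriv (i + 1) (partial_deriv (j + 1) f) x)"

definition nondegenerate_critical_point ::
    "nat \<Rightarrow> ((nat \<Rightarrow> real) \<Rightarrow> real) \<Rightarrow> (nat \<Rightarrow> real) \<Rightarrow> bool" where
  "nondegenerate_critical_point m f x \<longleftrightarrow>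
     critical_point {1..m} f x \<and>
     (\<exists>U. openin (powertop_real {1..m}) U \<and> x \<in> U \<and> C2_on {1..m} f U) \<and>
     invertible_mat (hessian m f x)"

definition nondegenerate_critical_circuit ::
    "nat \<Rightarrow> (nat \<Rightarrow> real) \<Rightarrow> (nat \<Rightarrow> complex) \<Rightarrow> bool" where
  "nondegenerate_critical_circuit n r p \<longleftrightarrow>
     nondegenerate_critical_point (n - 1) (perimeter_of_angles n r) (polar_angles n p)"


section \<open>Admissible radii\<close>

definition admissible_radii :: "nat \<Rightarrow> (nat \<Rightarrow> real) set" where
  "admissible_radii n =
     {r \<in> (\<Pi>\<^sub>E i\<in>{1..n}. {0<..}). inj_on r {1..n} \<and> r n = Max (r ` {1..n})}"

definition radii_space :: "nat \<Rightarrow> (nat \<Rightarrow> real) topology" where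
  "radii_space n = subtopology (powertop_real {1..n}) (admissible_radii n)"

lemma topspace_radii_space: "topspace (radii_space n) = admissible_radii n"
  by (auto simp: radii_space_def admissible_radii_def PiE_def)

end

theory Submission
  imports Defs "Jordan_Normal_Form.Determinant"
begin

text \<open>
  In angle coordinates the perimeter is a sum of functions of the differences of consecutive
  angles. At a parade all their first derivatives vanish, and the Hessian is the Laplacian of the
  \<open>n\<close>-cycle with edge weights \<open>w\<^sub>i = x\<^sub>i x\<^sub>i\<^sub>+\<^sub>1 / \<bar>x\<^sub>i - x\<^sub>i\<^sub>+\<^sub>1\<bar>\<close>, where \<open>x\<^sub>i\<close> is \<open>r\<^sub>i\<close> or
  \<open>-r\<^sub>i\<close>, grounded at vertex \<open>n\<close>. It is invertible iff \<open>\<Sum>\<^sub>i 1 / w\<^sub>i \<noteq> 0\<close>. As the outer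
  circle is the largest, this sum depends on \<open>r\<^sub>n\<close> only through the summand \<open>-2 / r\<^sub>n\<close>, whatever
  the signs are; so for each of the finitely many choices of signs it vanishes for at most one value
  of \<open>r\<^sub>n\<close>, and enlarging \<open>r\<^sub>n\<close> slightly makes all these sums nonzero.
\<close>

section \<open>Invertibility of a real matrix from its kernel\<close>

lemma invertible_mat_if_trivial_kernel:
  fixes A :: "real mat"
  assumes A: "A \<in> carrier_mat m m"
    and ker: "\<And>v. v \<in> carrier_vec m \<Longrightarrow> A *\<^sub>v v = 0\<^sub>v m \<Longrightarrow> v = 0\<^sub>v m"
  shows "invertible_mat A"
proof -
  have "A \<in> Units (ring_mat TYPE(real) m ())"
    by (rule det_non_zero_imp_unit[OF A]) (use ker det_0_iff_vec_prod_zero_field[OF A] in blast)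
  then obtain B where "B \<in> carrier_mat m m" "B * A = 1\<^sub>m m" "A * B = 1\<^sub>m m"
    unfolding Units_def ring_mat_def by auto
  then show ?thesis using A
    unfolding invertible_mat_def inverts_mat_def square_mat.simps by auto
qed

section \<open>Weighted Laplacian of a cycle\<close>

text \<open>Signed incidence matrix of the oriented \<open>n\<close>-cycle, with edges as rows and
  vertices as columns: edge \<open>i\<close> leads from vertex \<open>i\<close> to its cyclic
  successor.\<close>

definition inc :: "nat \<Rightarrow> nat \<Rightarrow> nat \<Rightarrow> real" where
  "inc n i k = of_bool (i = k) - of_bool (i mod n + 1 = k)"

lemma succ_in: "(n::nat) \<ge> 1 \<Longrightarrow> i mod n + 1 \<in> {1..n}"
  using mod_less_divisor[of n i] by (simp add: Suc_leI del: mod_less_divisor)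

lemma succ_eq_iff:
  fixes i k n :: nat
  assumes "i \<in> {1..n}" "k \<in> {1..n}"
  shows "i mod n + 1 = k \<longleftrightarrow> i = (if k = 1 then n else k - 1)"
proof (cases "i = n")
  case True
  then show ?thesis using assms by (auto split: if_splits)
next
  case False
  then have "i mod n = i" using assms by simp
  then show ?thesis using assms False by (auto split: if_splits)
qed

text \<open>The cyclic successor permutes \<open>{1..n}\<close>; hence potential drops around the
  cycle cancel.\<close>

lemma sum_succ:
  fixes V :: "nat \<Rightarrow> real"
  assumes "n \<ge> 1"
  shows "(\<Sum>i=1..n. V (i mod n + 1)) = (\<Sum>i=1..n. V i)"
proof (rule sum.reindex_bij_witness[where j = "\<lambda>i. i mod n + 1"
      and i = "\<lambda>k. if k = 1 then n else k - 1"])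
  show "a \<in> {1..n} \<Longrightarrow> (if a mod n + 1 = 1 then n else a mod n + 1 - 1) = a" for a
    using succ_eq_iff[of a n "a mod n + 1"] succ_in[of n a] assms by auto
  show "a \<in> {1..n} \<Longrightarrow> a mod n + 1 \<in> {1..n}" for a
    using succ_in assms by blast
qed (use assms in auto)

text \<open>Since \<open>V n = 0\<close>, the missing column \<open>n\<close> can be adjoined at no
  cost; row \<open>i\<close> then yields the potential drop along edge \<open>i\<close>.\<close>

lemma sum_inc_vertices:
  fixes V :: "nat \<Rightarrow> real"
  assumes "n \<ge> 1" "V n = 0" "i \<in> {1..n}"
  shows "(\<Sum>l=1..<n. inc n i l * V l) = V i - V (i mod n + 1)"
proof -
  have "(\<Sum>l=1..<n. inc n i l * V l) = (\<Sum>l=1..n. inc n i l * V l)"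
    by (rule sum.mono_neutral_left) (use assms in \<open>auto simp: not_less\<close>)
  also have "\<dots> = (\<Sum>l=1..n. (if i = l then V l else 0))
      - (\<Sum>l=1..n. (if i mod n + 1 = l then V l else 0))"
    unfolding sum_subtractf[symmetric] by (rule sum.cong) (auto simp: inc_def)
  also have "\<dots> = V i - V (i mod n + 1)"
    using assms succ_in[of n i] by simp
  finally show ?thesis .
qed

text \<open>Edge \<open>k\<close> leaves vertex \<open>k\<close> and the edge before it enters, so
  column \<open>k\<close> computes the net outflow of \<open>f\<close> at \<open>k\<close>.\<close>

lemma sum_inc_edges:
  fixes f :: "nat \<Rightarrow> real"
  assumes "k \<in> {1..n}"
  shows "(\<Sum>i=1..n. inc n i k * f i) = f k - f (if k = 1 then n else k - 1)"
proof -
  define j where "j = (if k = 1 then n else k - 1)"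
  have "(\<Sum>i=1..n. inc n i k * f i)
      = (\<Sum>i=1..n. (if i = k then f i else 0)) - (\<Sum>i=1..n. (if i = j then f i else 0))"
    unfolding sum_subtractf[symmetric]
  proof (rule sum.cong)
    fix i assume "i \<in> {1..n}"
    show "inc n i k * f i = (if i = k then f i else 0) - (if i = j then f i else 0)"
      unfolding inc_def succ_eq_iff[OF \<open>i \<in> {1..n}\<close> assms] j_def[symmetric] by simp
  qed simp
  also have "\<dots> = f k - f j"
    using assms by (auto simp: j_def)
  finally show ?thesis by (simp add: j_def)
qed

text \<open>The flow \<open>w i * (V i - V (i mod n + 1))\<close> is conserved at every vertex but \<open>n\<close>, hence
  equal to a constant \<open>c\<close>, and the potential drops around the cycle add up to
  \<open>c * (\<Sum>i=1..n. 1 / w i) = 0\<close>.\<close>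

lemma cycle_laplacian_kernel:
  fixes V w :: "nat \<Rightarrow> real"
  assumes n: "n \<ge> 2" and Vn: "V n = 0"
    and w: "\<And>i. i \<in> {1..n} \<Longrightarrow> w i \<noteq> 0"
    and res: "(\<Sum>i=1..n. 1 / w i) \<noteq> 0"
    and ker: "\<And>k. k \<in> {1..<n} \<Longrightarrow> (\<Sum>i=1..n. inc n i k * (w i * (V i - V (i mod n + 1)))) = 0"
    and i: "i \<in> {1..n}"
  shows "V i = 0"
proof -
  define f where "f i = w i * (V i - V (i mod n + 1))" for i
  have step: "f k = f (if k = 1 then n else k - 1)" if "k \<in> {1..<n}" for k
    using ker[OF that] sum_inc_edges[of k n f] that by (simp add: f_def)
  have const: "f k = f n" if "k \<ge> 1" "k < n" for k
    using that
  proof (induction k rule: dec_induct)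
    case base
    then show ?case using step[of 1] by simp
  next
    case (step k)
    then show ?case using \<open>\<And>k. k \<in> {1..<n} \<Longrightarrow> f k = f (if k = 1 then n else k - 1)\<close>[of "Suc k"] by simp
  qed
  have f: "f k = f n" if "k \<in> {1..n}" for k
    using const[of k] that by (cases "k = n") auto
  have drop: "V k - V (k mod n + 1) = f n * (1 / w k)" if "k \<in> {1..n}" for k
    using f[OF that] w[OF that] by (simp add: f_def field_simps)
  have "0 = (\<Sum>k=1..n. V k - V (k mod n + 1))"
    using sum_succ[of n V] n by (simp add: sum_subtractf)
  also have "\<dots> = (\<Sum>k=1..n. f n * (1 / w k))"
    by (rule sum.cong) (use drop in auto)
  also have "\<dots> = f n * (\<Sum>k=1..n. 1 / w k)"
    by (simp only: sum_distrib_left)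
  finally have "f n = 0" using res by simp
  then have eq: "V k = V (k mod n + 1)" if "k \<in> {1..n}" for k
    using drop[OF that] by simp
  have "k \<ge> 1 \<Longrightarrow> k \<le> n \<Longrightarrow> V k = 0" for k
  proof (induction k rule: dec_induct)
    case base
    \<comment> \<open>The closing edge \<open>n\<close> ties vertex 1 to the grounded vertex; from
      there zero spreads along the cycle.\<close>
    then show ?case using eq[of n] Vn n by simp
  next
    case (step k)
    then show ?case using eq[of k] by simp
  qed
  then show ?thesis using i by simp
qed

section \<open>Derivatives of the perimeter\<close>

text \<open>Angle tuples have no coordinate \<open>n\<close>; the update supplies the polar angle 0
  of the fixed vertex \<open>p n\<close>.\<close>

definition turn :: "nat \<Rightarrow> (nat \<Rightarrow> real) \<Rightarrow> nat \<Rightarrow> real" where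
  "turn n x i = (x(n := 0)) i - (x(n := 0)) (i mod n + 1)"

text \<open>Each difference is affine in every free angle, with an entry of the incidence matrix as
  slope.\<close>

lemma turn_upd:
  assumes "k \<in> {1..n-1}"
  shows "turn n (x(k := t)) i = turn n x i + inc n i k * (t - x k)"
  using assms by (auto simp: turn_def inc_def)

lemma continuous_map_turn:
  assumes "i \<in> {1..n}"
  shows "continuous_map (powertop_real {1..n-1}) euclideanreal (\<lambda>x. turn n x i)"
proof -
  have "continuous_map (powertop_real {1..n-1}) euclideanreal (\<lambda>x. (x(n := 0)) j)"
    if "j \<in> {1..n}" for j
    using that continuous_map_product_projection[of j "{1..n-1}" "\<lambda>_. euclideanreal"]
    by (cases "j = n") auto
  then show ?thesis
    unfolding turn_def using assms succ_in[of n i]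
    by (intro continuous_map_diff) auto
qed

context
  fixes n :: nat and m :: "nat \<Rightarrow> real" and h h' :: "nat \<Rightarrow> real \<Rightarrow> real"
    and f :: "(nat \<Rightarrow> real) \<Rightarrow> real"
  assumes h: "\<And>i \<phi>. i \<in> {1..n} \<Longrightarrow> (h i has_field_derivative h' i \<phi>) (at \<phi>)"
    and f: "\<And>x. f x = (\<Sum>i=1..n. m i * h i (turn n x i))"
begin

lemma has_partial_deriv_turn:
  assumes k: "k \<in> {1..n-1}"
  shows "((\<lambda>t. f (x(k := t))) has_field_derivative
      (\<Sum>i=1..n. m i * inc n i k * h' i (turn n x i))) (at (x k))"
proof -
  have "((\<lambda>t. m i * h i (turn n x i + inc n i k * (t - x k))) has_field_derivative
      m i * inc n i k * h' i (turn n x i)) (at (x k))" if "i \<in> {1..n}" for i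
  proof -
    have *: "((\<lambda>t. turn n x i + inc n i k * (t - x k)) has_field_derivative inc n i k) (at (x k))"
      by (auto intro!: derivative_eq_intros)
    show ?thesis
      using DERIV_cmult[OF DERIV_chain2[OF h[OF that] *], of "m i"] by (simp add: mult_ac)
  qed
  then show ?thesis
    unfolding f turn_upd[OF k] by (intro DERIV_sum)
qed

text \<open>The result again has the shape assumed of \<open>f\<close>, with weights
  \<open>m i * inc n i k\<close> and \<open>h'\<close> in place of \<open>h\<close>, so a second
  application gives the entries of the Hessian.\<close>

lemma partial_deriv_turn:
  assumes "k \<in> {1..n-1}"
  shows "partial_deriv k f x = (\<Sum>i=1..n. m i * inc n i k * h' i (turn n x i))"
  unfolding partial_deriv_def using has_partial_deriv_turn[OF assms] by (rule DERIV_imp_deriv)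

lemma C1_on_turn:
  assumes cont: "\<And>i. i \<in> {1..n} \<Longrightarrow> continuous_on UNIV (h' i)"
  shows "C1_on {1..n-1} f (topspace (powertop_real {1..n-1}))"
proof -
  have "continuous_map (powertop_real {1..n-1}) euclideanreal (\<lambda>x. h' i (turn n x i))"
    if "i \<in> {1..n}" for i
    using continuous_map_compose[OF continuous_map_turn[OF that], of euclideanreal "h' i"] cont[OF that]
    by (simp add: o_def)
  then have "continuous_map (powertop_real {1..n-1}) euclideanreal (partial_deriv k f)"
    if "k \<in> {1..n-1}" for k
    unfolding partial_deriv_turn[OF that, abs_def]
    by (intro continuous_map_sum continuous_map_real_mult_left) auto
  then show ?thesis
    unfolding C1_on_def subtopology_topspace
    using has_partial_deriv_turn real_differentiable_def by blast
qed

end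

section \<open>Side length as a function of the angle between its endpoints\<close>

text \<open>Law of cosines for points at distances \<open>a\<close> and \<open>b\<close> from the
  origin.\<close>

definition chord :: "real \<Rightarrow> real \<Rightarrow> real \<Rightarrow> real" where
  "chord a b \<phi> = sqrt (a\<^sup>2 + b\<^sup>2 - 2 * a * b * cos \<phi>)"

definition chord_d1 :: "real \<Rightarrow> real \<Rightarrow> real \<Rightarrow> real" where
  "chord_d1 a b \<phi> = a * b * sin \<phi> / chord a b \<phi>"

text \<open>Split so that only the first summand survives where \<open>sin \<phi> = 0\<close>, as at
  a parade.\<close>

definition chord_d2 :: "real \<Rightarrow> real \<Rightarrow> real \<Rightarrow> real" where
  "chord_d2 a b \<phi> = a * b * cos \<phi> / chord a b \<phi> - (a * b * sin \<phi>)\<^sup>2 / chord a b \<phi> ^ 3"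

lemma dist_rcis: "dist (rcis a \<alpha>) (rcis b \<beta>) = chord a b (\<alpha> - \<beta>)"
proof -
  have "(a * cos \<alpha> - b * cos \<beta>)\<^sup>2 + (a * sin \<alpha> - b * sin \<beta>)\<^sup>2
      = a\<^sup>2 * ((cos \<alpha>)\<^sup>2 + (sin \<alpha>)\<^sup>2) + b\<^sup>2 * ((cos \<beta>)\<^sup>2 + (sin \<beta>)\<^sup>2)
        - 2 * a * b * (cos \<alpha> * cos \<beta> + sin \<alpha> * sin \<beta>)"
    by (simp only: power2_diff power_mult_distrib) (simp only: algebra_simps)
  then show ?thesis
    by (simp add: dist_norm cmod_def chord_def cos_diff)
qed

text \<open>The radicand is at least \<open>(a - b)\<^sup>2\<close>. Distinct concentric circles are
  disjoint, so no side shrinks to a point and the square root stays smooth.\<close>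

lemma chord_radicand_pos:
  fixes a b :: real
  assumes "a > 0" "b > 0" "a \<noteq> b"
  shows "a\<^sup>2 + b\<^sup>2 - 2 * a * b * cos \<phi> > 0"
proof -
  have "2 * a * b * cos \<phi> \<le> 2 * a * b * 1"
    using assms by (intro mult_left_mono) auto
  moreover have "(a - b)\<^sup>2 > 0" using assms by simp
  ultimately show ?thesis by (simp add: power2_eq_square algebra_simps)
qed

lemma chord_pos: "a > 0 \<Longrightarrow> b > 0 \<Longrightarrow> a \<noteq> b \<Longrightarrow> chord a b \<phi> > 0"
  unfolding chord_def by (rule real_sqrt_gt_zero, rule chord_radicand_pos)

lemma chord_deriv:
  assumes "a > 0" "b > 0" "a \<noteq> b"
  shows "(chord a b has_field_derivative chord_d1 a b \<phi>) (at \<phi>)"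
proof -
  have "((\<lambda>\<phi>. a\<^sup>2 + b\<^sup>2 - 2 * a * b * cos \<phi>) has_field_derivative 2 * a * b * sin \<phi>) (at \<phi>)"
    by (auto intro!: derivative_eq_intros)
  then have "((\<lambda>\<phi>. sqrt (a\<^sup>2 + b\<^sup>2 - 2 * a * b * cos \<phi>)) has_field_derivative
      inverse (sqrt (a\<^sup>2 + b\<^sup>2 - 2 * a * b * cos \<phi>)) / 2 * (2 * a * b * sin \<phi>)) (at \<phi>)"
    by (rule DERIV_chain2[where g = "\<lambda>\<phi>. a\<^sup>2 + b\<^sup>2 - 2 * a * b * cos \<phi>",
          OF DERIV_real_sqrt[OF chord_radicand_pos[OF assms]]])
  moreover have "inverse s / 2 * (2 * a * b * sin \<phi>) = a * b * sin \<phi> / s" for s :: real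
    by (cases "s = 0") (simp_all add: field_simps)
  ultimately show ?thesis
    unfolding chord_def [abs_def] chord_d1_def by (simp only:)
qed

lemma chord_d1_deriv:
  assumes "a > 0" "b > 0" "a \<noteq> b"
  shows "(chord_d1 a b has_field_derivative chord_d2 a b \<phi>) (at \<phi>)"
proof -
  have "((\<lambda>\<phi>. a * b * sin \<phi> / chord a b \<phi>) has_field_derivative
     (a * b * cos \<phi> * chord a b \<phi> - a * b * sin \<phi> * chord_d1 a b \<phi>)
       / (chord a b \<phi> * chord a b \<phi>)) (at \<phi>)"
    using chord_pos[OF assms, of \<phi>]
    by (intro DERIV_divide chord_deriv[OF assms]) (auto intro!: derivative_eq_intros)
  moreover have "(a * b * cos \<phi> * chord a b \<phi> - a * b * sin \<phi> * chord_d1 a b \<phi>)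
       / (chord a b \<phi> * chord a b \<phi>) = chord_d2 a b \<phi>"
    using chord_pos[OF assms, of \<phi>]
    by (simp add: chord_d1_def chord_d2_def divide_simps power2_eq_square power3_eq_cube)
  ultimately show ?thesis by (simp add: chord_d1_def [abs_def])
qed

lemma continuous_chord_d1:
  assumes "a > 0" "b > 0" "a \<noteq> b"
  shows "continuous_on UNIV (chord_d1 a b)"
  by (rule DERIV_continuous_on) (rule chord_d1_deriv[OF assms])

lemma continuous_chord_d2:
  assumes "a > 0" "b > 0" "a \<noteq> b"
  shows "continuous_on UNIV (chord_d2 a b)"
proof -
  have nz: "chord a b \<phi> \<noteq> 0" for \<phi> using chord_pos[OF assms, of \<phi>] by simp
  have "continuous_on UNIV (chord a b)"
    by (rule DERIV_continuous_on) (rule chord_deriv[OF assms])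
  then show ?thesis unfolding chord_d2_def [abs_def]
    by (intro continuous_on_diff continuous_on_divide continuous_on_mult continuous_on_power
        continuous_on_const continuous_on_cos continuous_on_sin continuous_on_id) (simp_all add: nz)
qed

text \<open>Writing the fixed vertex as \<open>rcis (r n) 0\<close> treats the two sides at it like
  all others.\<close>

lemma perimeter_of_angles_eq:
  assumes "n \<ge> 1"
  shows "perimeter_of_angles n r x = (\<Sum>i=1..n. chord (r i) (r (i mod n + 1)) (turn n x i))"
proof -
  have "circuit_of_angles n r x i = rcis (r i) ((x(n := 0)) i)" if "i \<in> {1..n}" for i
    using that by (auto simp: circuit_of_angles_def rcis_def)
  then show ?thesis
    unfolding perimeter_of_angles_def perimeter_def turn_def using assms succ_in[of n]
    by (intro sum.cong) (auto simp: dist_rcis simp del: fun_upd_apply)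
qed

section \<open>Parades\<close>

text \<open>At the parade with \<open>p i = e i * r i\<close>, where \<open>e i\<close> is \<open>1\<close> or \<open>-1\<close>, the summands are the
  inverses of the edge weights of the Hessian, which is a reduced Laplacian of the \<open>n\<close>-cycle.\<close>

definition resistance :: "nat \<Rightarrow> (nat \<Rightarrow> real) \<Rightarrow> (nat \<Rightarrow> real) \<Rightarrow> real" where
  "resistance n e r = (\<Sum>i=1..n. e i * e (i mod n + 1) *
     \<bar>e i * r i - e (i mod n + 1) * r (i mod n + 1)\<bar> / (r i * r (i mod n + 1)))"

text \<open>Extensionality makes the set of sign vectors finite, so only finitely many equations
  have to be avoided.\<close>

definition generic_radii :: "nat \<Rightarrow> (nat \<Rightarrow> real) set" where
  "generic_radii n =
     {r \<in> admissible_radii n. \<forall>e \<in> {1..n} \<rightarrow>\<^sub>E {-1, 1}. resistance n e r \<noteq> 0}"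

section \<open>Admissible radii\<close>

lemma admissible_pos: "r \<in> admissible_radii n \<Longrightarrow> i \<in> {1..n} \<Longrightarrow> r i > 0"
  unfolding admissible_radii_def by blast

lemma admissible_extensional: "r \<in> admissible_radii n \<Longrightarrow> r \<in> extensional {1..n}"
  by (simp add: admissible_radii_def PiE_def)

text \<open>For \<open>n \<ge> 2\<close> a vertex differs from its successor, so injectivity
  separates their radii. These are the hypotheses of the \<open>chord\<close> lemmas.\<close>

lemma admissible_adjacent:
  assumes r: "r \<in> admissible_radii n" and "n \<ge> 2" and i: "i \<in> {1..n}"
  shows "r i > 0" "r (i mod n + 1) > 0" "r i \<noteq> r (i mod n + 1)"
proof -
  have s: "i mod n + 1 \<in> {1..n}" using succ_in assms by simp
  show "r i > 0" "r (i mod n + 1) > 0"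
    using admissible_pos[OF r i] admissible_pos[OF r s] by auto
  have "inj_on r {1..n}" using r unfolding admissible_radii_def by blast
  moreover have "i mod n + 1 \<noteq> i" using assms by (cases "i = n") auto
  ultimately show "r i \<noteq> r (i mod n + 1)"
    using i s inj_onD by metis
qed

lemma admissible_less_outer:
  assumes "r \<in> admissible_radii n" "i \<in> {1..<n}"
  shows "r i < r n"
proof -
  have "r n = Max (r ` {1..n})" using assms by (simp add: admissible_radii_def)
  also have "r i \<le> Max (r ` {1..n})" using assms by (intro Max_ge) auto
  finally have "r i \<le> r n" .
  moreover have "r i \<noteq> r n"
    using assms inj_onD[of r "{1..n}" i n] by (auto simp: admissible_radii_def)
  ultimately show ?thesis by linarith
qed

section \<open>The Hessian at a parade\<close>

text \<open>With \<open>cos \<phi> = e * e'\<close> the radicand is a perfect square, and the chord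
  is the distance of the signed radii on the line. The sign \<open>e * e'\<close> is its own
  inverse, so it survives in the reciprocal.\<close>

lemma chord_d2_aligned:
  assumes "e \<in> {-1, 1}" "e' \<in> {-1, 1}" "cos \<phi> = e * e'" "sin \<phi> = 0" "a > 0" "b > 0" "a \<noteq> b"
  shows "chord_d2 a b \<phi> \<noteq> 0" "1 / chord_d2 a b \<phi> = e * e' * \<bar>e * a - e' * b\<bar> / (a * b)"
proof -
  have "a\<^sup>2 + b\<^sup>2 - 2 * a * b * cos \<phi> = (e * a - e' * b)\<^sup>2"
    using assms by (auto simp: power2_eq_square algebra_simps)
  then have c: "chord a b \<phi> = \<bar>e * a - e' * b\<bar>" by (simp add: chord_def)
  have "chord_d2 a b \<phi> = a * b * (e * e') / \<bar>e * a - e' * b\<bar>"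
    using assms(3,4) by (simp add: chord_d2_def c)
  moreover have "e * a - e' * b \<noteq> 0" using assms by auto
  moreover have "e * e' = 1 \<or> e * e' = -1" using assms(1,2) by auto
  ultimately show "chord_d2 a b \<phi> \<noteq> 0"
      "1 / chord_d2 a b \<phi> = e * e' * \<bar>e * a - e' * b\<bar> / (a * b)"
    using assms(5,6) by (elim disjE; simp)+
qed

text \<open>A kernel vector of the Hessian is a potential on the cycle grounded at \<open>n\<close>.
  The reciprocal edge weights add up to \<open>resistance n e r\<close>, so
  \<open>cycle_laplacian_kernel\<close> forces it to vanish.\<close>

lemma parade_nondegenerate:
  assumes n: "n \<ge> 2" and r: "r \<in> generic_radii n"
    and p: "p \<in> reduced_circuits n r" "parade n p"
  shows "nondegenerate_critical_circuit n r p"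
proof -
  let ?L = "perimeter_of_angles n r"
  let ?X = "powertop_real {1..n-1}"
  define \<theta> where "\<theta> = polar_angles n p"
  define h where "h i = chord (r i) (r (i mod n + 1))" for i
  define h1 where "h1 i = chord_d1 (r i) (r (i mod n + 1))" for i
  define h2 where "h2 i = chord_d2 (r i) (r (i mod n + 1))" for i
  have adm: "r \<in> admissible_radii n" using r by (simp add: generic_radii_def)
  note adj = admissible_adjacent[OF adm n]
  have d: "(h i has_field_derivative h1 i \<phi>) (at \<phi>)"
      "(h1 i has_field_derivative h2 i \<phi>) (at \<phi>)"
      "continuous_on UNIV (h1 i)" "continuous_on UNIV (h2 i)" if "i \<in> {1..n}" for i \<phi>
    unfolding h_def h1_def h2_def
    by (intro chord_deriv chord_d1_deriv continuous_chord_d1 continuous_chord_d2 adj that)+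
  have L: "?L x = (\<Sum>i=1..n. 1 * h i (turn n x i))" for x
    using n by (simp add: perimeter_of_angles_eq h_def)
  have D1: "partial_deriv k ?L x = (\<Sum>i=1..n. inc n i k * h1 i (turn n x i))"
    if "k \<in> {1..n-1}" for k x
    using partial_deriv_turn[of n h h1 ?L "\<lambda>_. 1" k x] d(1) L that by simp
  have D2: "partial_deriv k (partial_deriv l ?L) x
      = (\<Sum>i=1..n. inc n i l * inc n i k * h2 i (turn n x i))"
    if "k \<in> {1..n-1}" "l \<in> {1..n-1}" for k l x
    by (rule partial_deriv_turn[of n h1 h2]) (use d(2) D1 that in auto)
  have C1: "C1_on {1..n-1} ?L (topspace ?X)"
    by (rule C1_on_turn[of n h h1 ?L "\<lambda>_. 1"]) (use d L in auto)
  have "C1_on {1..n-1} (partial_deriv l ?L) (topspace ?X)" if "l \<in> {1..n-1}" for l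
    by (rule C1_on_turn[of n h1 h2 _ "\<lambda>i. inc n i l"]) (use d D1 that in auto)
  with C1 have C2: "C2_on {1..n-1} ?L (topspace ?X)"
    by (simp add: C2_on_def)
  have \<theta>: "\<theta> \<in> topspace ?X"
    by (auto simp: \<theta>_def polar_angles_def)

  \<comment> \<open>The signs are the cosines of the angles 0 and \<open>pi\<close>; the restriction
    puts \<open>e\<close> among the sign vectors of \<open>generic_radii\<close>.\<close>
  define e where "e = (\<lambda>i\<in>{1..n}. cos ((\<theta>(n := 0)) i))"
  have angle: "(\<theta>(n := 0)) i = 0 \<or> (\<theta>(n := 0)) i = pi" if "i \<in> {1..n}" for i
    using p(2) that by (auto simp: parade_def \<theta>_def polar_angles_def)
  have e: "e i \<in> {-1, 1}" if "i \<in> {1..n}" for i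
    using angle[OF that] that by (auto simp: e_def)
  have turn: "sin (turn n \<theta> i) = 0" "cos (turn n \<theta> i) = e i * e (i mod n + 1)"
    if "i \<in> {1..n}" for i
  proof -
    have s: "i mod n + 1 \<in> {1..n}" using succ_in n by simp
    show "sin (turn n \<theta> i) = 0" "cos (turn n \<theta> i) = e i * e (i mod n + 1)"
      using angle[OF that] angle[OF s] that s
      by (auto simp: turn_def e_def sin_diff cos_diff simp del: fun_upd_apply)
  qed
  define w where "w i = h2 i (turn n \<theta> i)" for i
  have w: "w i \<noteq> 0" "1 / w i = e i * e (i mod n + 1) *
     \<bar>e i * r i - e (i mod n + 1) * r (i mod n + 1)\<bar> / (r i * r (i mod n + 1))"
    if "i \<in> {1..n}" for i
  proof -
    have s: "i mod n + 1 \<in> {1..n}" using succ_in n by simp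
    note aligned = chord_d2_aligned[OF e[OF that] e[OF s] turn(2)[OF that] turn(1)[OF that] adj[OF that]]
    show "w i \<noteq> 0" "1 / w i = e i * e (i mod n + 1) *
       \<bar>e i * r i - e (i mod n + 1) * r (i mod n + 1)\<bar> / (r i * r (i mod n + 1))"
      unfolding w_def h2_def by (fact aligned)+
  qed
  have "(\<Sum>i=1..n. 1 / w i) = resistance n e r"
    unfolding resistance_def using w(2) by (intro sum.cong) auto
  moreover have "e \<in> {1..n} \<rightarrow>\<^sub>E {-1, 1}"
    using e by (auto simp: PiE_iff e_def)
  ultimately have res: "(\<Sum>i=1..n. 1 / w i) \<noteq> 0"
    using r by (auto simp: generic_radii_def)

  have "invertible_mat (hessian (n - 1) ?L \<theta>)"
  proof (rule invertible_mat_if_trivial_kernel)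
    show "hessian (n - 1) ?L \<theta> \<in> carrier_mat (n - 1) (n - 1)"
      by (simp add: hessian_def)
  next
    fix v :: "real Matrix.vec"
    assume v: "v \<in> carrier_vec (n - 1)" and Hv: "hessian (n - 1) ?L \<theta> *\<^sub>v v = 0\<^sub>v (n - 1)"
    \<comment> \<open>Matrix indices start at 0, vertices at 1; the value 0 at \<open>n\<close>
      grounds the potential.\<close>
    define V where "V i = (if i = n then 0 else vec_index v (i - 1))" for i
    have "(\<Sum>i=1..n. inc n i k * (w i * (V i - V (i mod n + 1)))) = 0" if k: "k \<in> {1..<n}" for k
    proof -
      have k': "k - 1 < n - 1" "k \<in> {1..n-1}" using k by auto
      have "0 = vec_index (hessian (n - 1) ?L \<theta> *\<^sub>v v) (k - 1)"
        using Hv k' by simp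
      also have "\<dots> = scalar_prod (row (hessian (n - 1) ?L \<theta>) (k - 1)) v"
        by (rule index_mult_mat_vec) (use k' in \<open>simp add: hessian_def\<close>)
      also have "\<dots> = (\<Sum>j=0..<n-1. partial_deriv k (partial_deriv (j + 1) ?L) \<theta> * vec_index v j)"
        unfolding scalar_prod_def using v k k'(1)
        by (intro sum.cong) (simp_all add: hessian_def del: One_nat_def)
      also have "\<dots> = (\<Sum>l=1..<n. partial_deriv k (partial_deriv l ?L) \<theta> * V l)"
        by (rule sum.reindex_bij_witness[where i = "\<lambda>l. l - 1" and j = "\<lambda>j. j + 1"])
           (auto simp: V_def)
      also have "\<dots> = (\<Sum>l=1..<n. \<Sum>i=1..n. inc n i k * (w i * (inc n i l * V l)))"
      proof (intro sum.cong refl)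
        fix l assume "l \<in> {1..<n}"
        then have "l \<in> {1..n-1}" by auto
        then show "partial_deriv k (partial_deriv l ?L) \<theta> * V l
            = (\<Sum>i=1..n. inc n i k * (w i * (inc n i l * V l)))"
          unfolding D2[OF k'(2) \<open>l \<in> {1..n-1}\<close>] sum_distrib_right
          by (intro sum.cong) (simp_all add: w_def mult_ac)
      qed
      \<comment> \<open>The Hessian is the transpose of \<open>inc\<close> times the diagonal matrix
        of \<open>w\<close> times \<open>inc\<close>; swapping the sums applies the right-hand
        \<open>inc\<close> to \<open>V\<close> first.\<close>
      also have "\<dots> = (\<Sum>i=1..n. inc n i k * (w i * (\<Sum>l=1..<n. inc n i l * V l)))"
        by (subst sum.swap) (simp add: sum_distrib_left)
      also have "\<dots> = (\<Sum>i=1..n. inc n i k * (w i * (V i - V (i mod n + 1))))"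
        using n by (intro sum.cong refl) (subst sum_inc_vertices; auto simp: V_def)
      finally show ?thesis by simp
    qed
    then have V: "V i = 0" if "i \<in> {1..n}" for i
      using cycle_laplacian_kernel[OF n _ w(1) res _ that, of V] by (simp add: V_def)
    show "v = 0\<^sub>v (n - 1)"
    proof (rule eq_vecI)
      fix j assume "j < dim_vec (0\<^sub>v (n - 1) :: real Matrix.vec)"
      then have j: "j < n - 1" by simp
      then have "j + 1 \<in> {1..n}" "j + 1 \<noteq> n" by auto
      then show "vec_index v j = vec_index (0\<^sub>v (n - 1)) j"
        using V[of "j + 1"] j by (simp add: V_def)
    qed (use v in simp)
  qed
  \<comment> \<open>Every summand carries the sine of a turn, which is 0 at a parade.\<close>
  moreover have "partial_deriv k ?L \<theta> = 0" if "k \<in> {1..n-1}" for k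
    unfolding D1[OF that] h1_def chord_d1_def using turn(1) by simp
  ultimately show ?thesis
    unfolding nondegenerate_critical_circuit_def nondegenerate_critical_point_def
      critical_point_def \<theta>_def[symmetric]
    using C1 C2 \<theta> openin_topspace by blast
qed

section \<open>Genericity\<close>

lemma continuous_map_resistance:
  assumes n: "n \<ge> 2"
  shows "continuous_map (radii_space n) euclideanreal (resistance n e)"
proof -
  have c: "continuous_map (radii_space n) euclideanreal (\<lambda>r. r i)" if "i \<in> {1..n}" for i
    unfolding radii_space_def
    using that by (intro continuous_map_from_subtopology continuous_map_product_projection)
  have s: "i mod n + 1 \<in> {1..n}" for i using succ_in n by simp
  show ?thesis
    unfolding resistance_def [abs_def]
  proof (intro continuous_map_sum continuous_map_real_divide continuous_map_real_mult_left
      continuous_map_real_abs continuous_map_diff continuous_map_real_mult c s)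
    fix i r assume "i \<in> {1..n}" "r \<in> topspace (radii_space n)"
    then show "r i * r (i mod n + 1) \<noteq> 0"
      using admissible_adjacent(1,2)[of r n i] n by (simp add: topspace_radii_space)
  qed auto
qed

lemma openin_generic_radii:
  assumes n: "n \<ge> 2"
  shows "openin (radii_space n) (generic_radii n)"
proof -
  let ?E = "{1..n} \<rightarrow>\<^sub>E {-1, 1 :: real}"
  have ne: "?E \<noteq> {}" by (simp add: PiE_eq_empty_iff)
  have *: "openin (radii_space n) {r \<in> topspace (radii_space n). resistance n e r \<noteq> 0}" for e
    using openin_continuous_map_preimage[OF continuous_map_resistance[OF n], of "- {0}" e]
    by (simp add: open_delete Compl_eq_Diff_UNIV)
  have "generic_radii n
      = (\<Inter>e\<in>?E. {r \<in> topspace (radii_space n). resistance n e r \<noteq> 0})"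
    using ne by (auto simp: generic_radii_def topspace_radii_space)
  also have "openin (radii_space n) \<dots>"
  proof (rule openin_Inter)
    show "finite ((\<lambda>e. {r \<in> topspace (radii_space n). resistance n e r \<noteq> 0}) ` ?E)"
      by (intro finite_imageI finite_PiE) auto
  qed (use ne * in blast)+
  finally show ?thesis .
qed

section \<open>Density of the generic radii\<close>

text \<open>As \<open>s < t\<close>, the absolute value opens to \<open>t - e * e' * s\<close>, so
  the part depending on \<open>t\<close> is free of signs.\<close>

lemma aligned_resistance:
  fixes s t :: real
  assumes "e \<in> {-1, 1}" "e' \<in> {-1, 1}" "0 < s" "s < t"
  shows "e * e' * \<bar>e * s - e' * t\<bar> / (s * t) = e * e' / s - 1 / t"
proof -
  have "\<bar>e * s - e' * t\<bar> = t - e * e' * s" using assms by auto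
  moreover have "e * e' * (e * e') = 1" using assms by auto
  ultimately show ?thesis
    using assms by (simp add: right_diff_distrib diff_divide_distrib flip: mult.assoc)
qed

lemma resistance_outer_radius:
  assumes n: "n \<ge> 2" and r: "r \<in> admissible_radii n" and e: "e \<in> {1..n} \<rightarrow>\<^sub>E {-1, 1}"
  shows "\<exists>K. \<forall>t\<ge>r n. resistance n e (r(n := t)) = K - 2 / t"
proof -
  \<comment> \<open>Sides \<open>1\<close> to \<open>m\<close> avoid the outer vertex; the last two
    sides meet it and contribute \<open>- 1 / t\<close> each.\<close>
  obtain m where m: "n = Suc (Suc m)" using n by (metis add_2_eq_Suc le_add_diff_inverse)
  have inner: "r i > 0" "r i < r n" if "i \<in> {1..<n}" for i
    using admissible_less_outer[OF r that] admissible_pos[OF r] that by auto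
  have e': "e i \<in> {-1, 1}" if "i \<in> {1..n}" for i
    using e that by (auto simp: PiE_iff)
  define F where "F r i = e i * e (i mod n + 1) *
     \<bar>e i * r i - e (i mod n + 1) * r (i mod n + 1)\<bar> / (r i * r (i mod n + 1))"
    for r :: "nat \<Rightarrow> real" and i
  show ?thesis
  proof (intro exI allI impI)
    fix t assume t: "r n \<le> t"
    have "(\<Sum>i=1..m. F (r(n := t)) i) = (\<Sum>i=1..m. F r i)"
      by (rule sum.cong) (auto simp: F_def m)
    moreover have "F (r(n := t)) (n - 1) = e (n - 1) * e n / r (n - 1) - 1 / t"
    proof -
      have i: "n - 1 \<in> {1..<n}" using n by auto
      have "F (r(n := t)) (n - 1) = e (n - 1) * e n * \<bar>e (n - 1) * r (n - 1) - e n * t\<bar> / (r (n - 1) * t)"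
        by (simp add: F_def m)
      also have "\<dots> = e (n - 1) * e n / r (n - 1) - 1 / t"
        using e' n t i inner[OF i] by (intro aligned_resistance) auto
      finally show ?thesis .
    qed
    moreover have "F (r(n := t)) n = e 1 * e n / r 1 - 1 / t"
    proof -
      have i: "1 \<in> {1..<n}" using n by auto
      have "F (r(n := t)) n = e n * e 1 * \<bar>e n * t - e 1 * r 1\<bar> / (t * r 1)"
        by (simp add: F_def m)
      \<comment> \<open>On side \<open>n\<close> the outer vertex comes first, so the ends are
        exchanged to have the smaller radius in front.\<close>
      also have "\<dots> = e 1 * e n * \<bar>e 1 * r 1 - e n * t\<bar> / (r 1 * t)"
        by (simp only: mult.commute[of "e n" "e 1"] mult.commute[of t "r 1"]
            abs_minus_commute[of "e n * t" "e 1 * r 1"])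
      also have "\<dots> = e 1 * e n / r 1 - 1 / t"
        using e' n t i inner[OF i] by (intro aligned_resistance) auto
      finally show ?thesis .
    qed
    ultimately show "resistance n e (r(n := t)) =
        (\<Sum>i=1..m. F r i) + e (n - 1) * e n / r (n - 1) + e 1 * e n / r 1 - 2 / t"
      unfolding resistance_def F_def[symmetric] by (simp add: m)
  qed
qed

lemma admissible_enlarge_outer:
  assumes n: "n \<ge> 1" and r: "r \<in> admissible_radii n" and t: "t \<ge> r n"
  shows "r(n := t) \<in> admissible_radii n"
proof -
  note lt = admissible_less_outer[OF r]
  have le: "r i \<le> t" if "i \<in> {1..n}" for i
    using lt[of i] t that by (cases "i = n") auto
  have "Max ((r(n := t)) ` {1..n}) = t"
    by (rule Max_eqI) (use n le in \<open>auto simp: image_iff\<close>)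
  moreover have "inj_on (r(n := t)) {1..n}"
  proof (rule inj_onI)
    fix i j assume ij: "i \<in> {1..n}" "j \<in> {1..n}" and eq: "(r(n := t)) i = (r(n := t)) j"
    have "i = j" if "i \<noteq> n" "j \<noteq> n"
      using r ij eq that inj_onD[of r "{1..n}" i j] by (simp add: admissible_radii_def)
    then show "i = j"
      using lt[of i] lt[of j] t ij eq by (cases "i = n"; cases "j = n") auto
  qed
  moreover have "r(n := t) \<in> {1..n} \<rightarrow>\<^sub>E {0<..}"
  proof -
    have "t > 0" using admissible_pos[OF r, of n] t n by auto
    then show ?thesis
      using admissible_pos[OF r] admissible_extensional[OF r] n
      by (auto simp: PiE_iff extensional_def)
  qed
  ultimately show ?thesis
    unfolding admissible_radii_def by simp
qed

lemma closure_of_generic_radii: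
  assumes n: "n \<ge> 2"
  shows "(radii_space n) closure_of (generic_radii n) = topspace (radii_space n)"
proof (intro equalityI closure_of_subset_topspace subsetI)
  fix r assume "r \<in> topspace (radii_space n)"
  then have r: "r \<in> admissible_radii n" by (simp add: topspace_radii_space)
  let ?E = "{1..n} \<rightarrow>\<^sub>E {-1, 1 :: real}"
  define B where "B = {t. t \<ge> r n \<and> (\<exists>e\<in>?E. resistance n e (r(n := t)) = 0)}"
  have rn: "r n > 0" using admissible_pos[OF r] n by simp
  have "finite {t. t \<ge> r n \<and> resistance n e (r(n := t)) = 0}" if "e \<in> ?E" for e
  proof -
    obtain K where K: "\<And>t. t \<ge> r n \<Longrightarrow> resistance n e (r(n := t)) = K - 2 / t"
      using resistance_outer_radius[OF n r \<open>e \<in> ?E\<close>] by blast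
    \<comment> \<open>If \<open>K = 0\<close> there is no zero at all, and the default
      \<open>2 / K = 0\<close> does no harm.\<close>
    have "{t. t \<ge> r n \<and> resistance n e (r(n := t)) = 0} \<subseteq> {2 / K}"
    proof
      fix t assume t: "t \<in> {t. t \<ge> r n \<and> resistance n e (r(n := t)) = 0}"
      then have "K = 2 / t" using K[of t] by simp
      then show "t \<in> {2 / K}" using t rn by simp
    qed
    then show ?thesis by (rule finite_subset) simp
  qed
  then have "finite (\<Union>e\<in>?E. {t. t \<ge> r n \<and> resistance n e (r(n := t)) = 0})"
    by (intro finite_UN_I finite_PiE) auto
  moreover have "B = (\<Union>e\<in>?E. {t. t \<ge> r n \<and> resistance n e (r(n := t)) = 0})"
    by (auto simp: B_def)
  ultimately have finB: "finite B" by simp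
  have "\<exists>y\<in>generic_radii n. y \<in> T" if T: "r \<in> T" "openin (radii_space n) T" for T
  proof -
    obtain T' where T': "openin (powertop_real {1..n}) T'" "T = T' \<inter> admissible_radii n"
      using T(2) by (auto simp: radii_space_def openin_subtopology)
    \<comment> \<open>Varying the outer radius alone is a continuous path, so the neighbourhood
      \<open>T'\<close> pulls back to an open set around \<open>r n\<close>.\<close>
    have "continuous_map euclideanreal (powertop_real {1..n}) (\<lambda>t. r(n := t))"
      unfolding continuous_map_componentwise
    proof (intro conjI ballI)
      show "(\<lambda>t. r(n := t)) ` topspace euclideanreal \<subseteq> extensional {1..n}"
        using admissible_extensional[OF r] n by (auto simp: extensional_def)
      show "continuous_map euclideanreal euclideanreal (\<lambda>t. (r(n := t)) i)" for i
        by (cases "i = n") auto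
    qed
    from openin_continuous_map_preimage[OF this T'(1)]
    have "open {t. r(n := t) \<in> T'}" by simp
    moreover have "r n \<in> {t. r(n := t) \<in> T'}" using T(1) T'(2) by simp
    ultimately obtain \<delta> where \<delta>: "\<delta> > 0" "ball (r n) \<delta> \<subseteq> {t. r(n := t) \<in> T'}"
      by (meson openE)
    \<comment> \<open>Only values from \<open>r n\<close> upwards are tried: they keep the outer
      circle largest, and \<open>B\<close> is known to be finite only among them.\<close>
    have "infinite ({r n..<r n + \<delta>} - B)"
      using finB \<delta>(1) by (simp add: infinite_Ico)
    then obtain t where t: "t \<in> {r n..<r n + \<delta>}" "t \<notin> B"
      by (metis Diff_iff finite.emptyI ex_in_conv)
    have adm: "r(n := t) \<in> admissible_radii n"
      using admissible_enlarge_outer[OF _ r, of t] n t by simp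
    moreover have "t \<in> ball (r n) \<delta>" using t by (simp add: dist_real_def)
    then have "r(n := t) \<in> T'" using \<delta>(2) by blast
    moreover have "r(n := t) \<in> generic_radii n"
      using adm t by (auto simp: generic_radii_def B_def)
    ultimately show ?thesis using T'(2) by blast
  qed
  then show "r \<in> (radii_space n) closure_of (generic_radii n)"
    using r by (auto simp: in_closure_of topspace_radii_space)
qed

theorem theorem2:
  fixes n :: nat
  assumes "n \<ge> 3"
  shows "\<exists>U. openin (radii_space n) U \<and>
             (radii_space n) closure_of U = topspace (radii_space n) \<and>
             (\<forall>r\<in>U. \<forall>p\<in>reduced_circuits n r.
                parade n p \<longrightarrow> nondegenerate_critical_circuit n r p)"
  using assms openin_generic_radii[of n] closure_of_generic_radii[of n] parade_nondegenerate[of n]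
  by (intro exI[of _ "generic_radii n"]) auto

end
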